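(* Let $n\ge 2$, $k\ge 1$, $t\ge 1$ be integers and let $D$ be a target distribution on $P_n^{(k)}$ of size $t$. Then $\pi(P_n^{(k)},D)\le p_t(n,k)-s(D)+1$.
   Context: For positive integers $n,k$, $P_n^{(k)}$ is the graph with vertices $v_1,\dots,v_n$ in which $v_i\sim v_j$ iff $1\le |i-j|\le k$. For $n\ge 2$ put $d=\lfloor (n-2)/k\rfloor+1$ (the diameter of $P_n^{(k)}$), $b=(n-2)-k(d-1)$ (so $0\le b<k$), $l_t(n,k)=t2^d+b$, $w_t(n)=2t+n-2$, and $p_t(n,k)=\max\{l_t(n,k),w_t(n)\}$. A configuration is a function $C:V\to\mathbb{N}$ of size $|C|=\sum_v C(v)$; a pebbling step from a vertex $u$ with at least two pebbles to a neighbor $w$ removes two pebbles from $u$ and adds one to $w$. A target distribution is $D:V\to\mathbb{N}$ with size $|D|=\sum_vD(v)$; $C$ is $D$-solvable if some sequence of pebbling steps results in at least $D(v)$ pebbles on every vertex $v$ simultaneously; $\pi(G,D)$ is the least $m$ such that every configuration of size at least $m$ on $G$ is $D$-solvable. $s(D)=|\{v: D(v)>0\}|$. *)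

theory Defs
  imports "Graph_Theory.Pair_Digraph"
begin

definition path_power :: "nat \<Rightarrow> nat \<Rightarrow> nat pair_pre_digraph" where
  "path_power n k = \<lparr>pverts = {1..n},
     parcs = {(i, j). i \<in> {1..n} \<and> j \<in> {1..n} \<and>
       1 \<le> \<bar>int i - int j\<bar> \<and> \<bar>int i - int j\<bar> \<le> int k}\<rparr>"

lemma pair_graph_path_power: "pair_graph (path_power n k)"
proof -
  have "parcs (path_power n k) \<subseteq> {1..n} \<times> {1..n}"
    by (auto simp: path_power_def)
  then have "finite (parcs (path_power n k))"
    by (rule finite_subset) simp
  then show ?thesis
    by unfold_locales
      (auto simp: path_power_def symmetric_def arcs_ends_def arc_to_ends_def abs_minus_commute
        intro!: symI)
qed

text \<open>Configurations and target distributions on a graph \<open>G\<close> are functions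
  \<open>'a \<Rightarrow> nat\<close> of which only the values on \<open>pverts G\<close> matter: none of the notions
  below depends on the values elsewhere.\<close>

definition distr_size :: "'a pair_pre_digraph \<Rightarrow> ('a \<Rightarrow> nat) \<Rightarrow> nat" where
  "distr_size G C = (\<Sum>v\<in>pverts G. C v)"

definition distr_supp :: "'a pair_pre_digraph \<Rightarrow> ('a \<Rightarrow> nat) \<Rightarrow> nat" where
  "distr_supp G D = card {v \<in> pverts G. D v > 0}"

definition pebbling_step :: "'a pair_pre_digraph \<Rightarrow> ('a \<Rightarrow> nat) \<Rightarrow> ('a \<Rightarrow> nat) \<Rightarrow> bool" where
  "pebbling_step G C C' \<longleftrightarrow>
     (\<exists>u w. (u, w) \<in> parcs G \<and> C u \<ge> 2 \<and> C' = C(u := C u - 2, w := C w + 1))"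

definition solvable :: "'a pair_pre_digraph \<Rightarrow> ('a \<Rightarrow> nat) \<Rightarrow> ('a \<Rightarrow> nat) \<Rightarrow> bool" where
  "solvable G D C \<longleftrightarrow>
     (\<exists>C'. (pebbling_step G)\<^sup>*\<^sup>* C C' \<and> (\<forall>v\<in>pverts G. C' v \<ge> D v))"

definition pebbling_number :: "'a pair_pre_digraph \<Rightarrow> ('a \<Rightarrow> nat) \<Rightarrow> nat" where
  "pebbling_number G D = (LEAST m. \<forall>C. distr_size G C \<ge> m \<longrightarrow> solvable G D C)"

text \<open>The following are meant for \<open>n \<ge> 2\<close> and \<open>k \<ge> 1\<close>; then no subtraction truncates.\<close>

definition pp_diam :: "nat \<Rightarrow> nat \<Rightarrow> nat" where
  "pp_diam n k = (n - 2) div k + 1"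

definition pp_rest :: "nat \<Rightarrow> nat \<Rightarrow> nat" where
  "pp_rest n k = (n - 2) - k * (pp_diam n k - 1)"

definition pp_l :: "nat \<Rightarrow> nat \<Rightarrow> nat \<Rightarrow> nat" where
  "pp_l t n k = t * 2 ^ pp_diam n k + pp_rest n k"

definition pp_w :: "nat \<Rightarrow> nat \<Rightarrow> nat" where
  "pp_w t n = 2 * t + n - 2"

definition pp_p :: "nat \<Rightarrow> nat \<Rightarrow> nat \<Rightarrow> nat" where
  "pp_p t n k = max (pp_l t n k) (pp_w t n)"

end

theory Submission
  imports Defs
begin

text \<open>
  Write \<open>f j = t * 2 ^ (j + 1) + (n - 2) - k * j\<close>. This is convex in \<open>j\<close>, so over the range
  \<open>0 \<le> j \<le> d - 1\<close> its maximum is attained at an end, and there the values are \<open>pp_w t n\<close> and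
  \<open>pp_l t n k\<close>. Hence it suffices to solve \<open>C\<close> whenever \<open>|C| \<ge> f j - s(D) + 1\<close> for all such \<open>j\<close>;
  unlike the bound with only the two end values, this hypothesis is inherited by smaller instances,
  which allows an induction on \<open>n\<close> and then on \<open>|C|\<close>.

  A pebble lying on a target is used there, so \<open>C\<close> may be taken to vanish on the targets. If the end
  vertex \<open>n\<close> is a target and some vertex of \<open>{n - k..<n}\<close> carries pebbles, then a unit of the demand
  at \<open>n\<close> is served by two pebbles of that vertex or, if it has only one, replaced by a unit of demand
  there. If that window is empty, every demand \<open>D x\<close> with \<open>x > n - k\<close> is replaced by the demand
  \<open>2 * D x\<close> at \<open>x - k\<close>; this passes from \<open>n\<close> to \<open>n - k\<close> and from \<open>j\<close> to \<open>j + 1\<close>. The vertex \<open>1\<close> is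
  treated by reflection. If neither end is a target, the demand is split at an interior target \<open>z\<close> into
  a part served from \<open>{1..z}\<close> and a part served from \<open>{z..n}\<close>; a suitable split exists because
  \<open>f\<close> is superadditive.
\<close>

section \<open>Solvability on an arbitrary graph\<close>

lemma pebbling_steps_add:
  assumes "(pebbling_step G)\<^sup>*\<^sup>* C E"
  shows "(pebbling_step G)\<^sup>*\<^sup>* (\<lambda>v. C v + X v) (\<lambda>v. E v + X v)"
  using assms
proof (induction rule: rtranclp_induct)
  case base
  show ?case by simp
next
  case (step E F)
  from step.hyps(2) obtain u w where uw: "(u, w) \<in> parcs G" "E u \<ge> 2"
      "F = E(u := E u - 2, w := E w + 1)"
    unfolding pebbling_step_def by blast
  have "(\<lambda>v. F v + X v) =
      (\<lambda>v. E v + X v)(u := E u + X u - 2, w := E w + X w + 1)"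
    using uw by (auto simp: fun_eq_iff)
  with uw have "pebbling_step G (\<lambda>v. E v + X v) (\<lambda>v. F v + X v)"
    unfolding pebbling_step_def by (intro exI[of _ u] exI[of _ w]) auto
  with step.IH show ?case by (simp only: rtranclp.rtrancl_into_rtrancl)
qed

text \<open>The two move sequences run one after the other; the pebbles belonging to the other
  instance lie idle meanwhile.\<close>

lemma solvable_add:
  assumes "solvable G D C" "solvable G D' C'"
  shows "solvable G (\<lambda>v. D v + D' v) (\<lambda>v. C v + C' v)"
proof -
  from assms(1) obtain E where E: "(pebbling_step G)\<^sup>*\<^sup>* C E" "\<forall>v\<in>pverts G. D v \<le> E v"
    unfolding solvable_def by blast
  from assms(2) obtain E' where E': "(pebbling_step G)\<^sup>*\<^sup>* C' E'" "\<forall>v\<in>pverts G. D' v \<le> E' v"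
    unfolding solvable_def by blast
  have "(pebbling_step G)\<^sup>*\<^sup>* (\<lambda>v. C v + C' v) (\<lambda>v. E v + C' v)"
    by (rule pebbling_steps_add) (rule E)
  also have "(pebbling_step G)\<^sup>*\<^sup>* (\<lambda>v. C' v + E v) (\<lambda>v. E' v + E v)"
    by (rule pebbling_steps_add) (rule E')
  then have "(pebbling_step G)\<^sup>*\<^sup>* (\<lambda>v. E v + C' v) (\<lambda>v. E v + E' v)"
    by (simp add: add.commute)
  finally show ?thesis
    unfolding solvable_def using E(2) E'(2) by (blast intro: add_mono)
qed

lemma solvable_if_le:
  assumes "\<And>v. v \<in> pverts G \<Longrightarrow> D v \<le> C v"
  shows "solvable G D C"
  unfolding solvable_def using assms by blast

lemma solvable_mono_target:
  assumes "solvable G D C" "\<And>v. v \<in> pverts G \<Longrightarrow> D' v \<le> D v"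
  shows "solvable G D' C"
  using assms unfolding solvable_def by (meson le_trans)

lemma solvable_sum:
  assumes "finite I" "\<And>i. i \<in> I \<Longrightarrow> solvable G (f i) (g i)"
  shows "solvable G (\<lambda>v. \<Sum>i\<in>I. f i v) (\<lambda>v. \<Sum>i\<in>I. g i v)"
  using assms by (induction I rule: finite_induct) (auto intro: solvable_if_le solvable_add)

lemma solvable_arc:
  assumes "(u, w) \<in> parcs G" "u \<noteq> w"
  shows "solvable G (\<lambda>v. if v = w then m else 0) (\<lambda>v. if v = u then 2 * m else 0)"
proof -
  have "pebbling_step G (\<lambda>v. if v = u then 2 else 0) (\<lambda>v. if v = w then 1 else 0)"
    unfolding pebbling_step_def using assms
    by (intro exI[of _ u] exI[of _ w]) (auto simp: fun_eq_iff)
  then have one: "solvable G (\<lambda>v. if v = w then 1 else 0) (\<lambda>v. if v = u then 2 else 0)"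
    unfolding solvable_def by (blast intro: order_refl)
  have "solvable G (\<lambda>v. \<Sum>i<m. if v = w then 1 else 0) (\<lambda>v. \<Sum>i<m. if v = u then 2 else 0)"
    by (rule solvable_sum) (auto intro: one)
  then show ?thesis by (simp add: if_distrib mult.commute cong: if_cong)
qed

text \<open>The larger configuration imitates each step of the smaller one. The comparison concerns
  vertices only, so values off the graph can be changed freely.\<close>

lemma solvable_mono:
  assumes "solvable G D C" "parcs G \<subseteq> pverts G \<times> pverts G"
    and "\<And>v. v \<in> pverts G \<Longrightarrow> C v \<le> C' v"
  shows "solvable G D C'"
proof -
  have "\<exists>E'. (pebbling_step G)\<^sup>*\<^sup>* C' E' \<and> (\<forall>v\<in>pverts G. E v \<le> E' v)"
    if "(pebbling_step G)\<^sup>*\<^sup>* C E" for E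
    using that
  proof (induction rule: rtranclp_induct)
    case base
    then show ?case using assms(3) by blast
  next
    case (step E F)
    then obtain E' where E': "(pebbling_step G)\<^sup>*\<^sup>* C' E'" "\<forall>v\<in>pverts G. E v \<le> E' v"
      by blast
    from step.hyps(2) obtain u w where uw: "(u, w) \<in> parcs G" "E u \<ge> 2"
        "F = E(u := E u - 2, w := E w + 1)"
      unfolding pebbling_step_def by blast
    let ?F = "E'(u := E' u - 2, w := E' w + 1)"
    have uw': "u \<in> pverts G" "w \<in> pverts G" using uw assms(2) by auto
    then have "E' u \<ge> 2" using uw E'(2) by (meson le_trans)
    then have "pebbling_step G E' ?F" unfolding pebbling_step_def using uw by blast
    with E'(1) have "(pebbling_step G)\<^sup>*\<^sup>* C' ?F" by (simp only: rtranclp.rtrancl_into_rtrancl)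
    moreover have "\<forall>v\<in>pverts G. F v \<le> ?F v" using uw uw' E'(2) by (auto intro: diff_le_mono)
    ultimately show ?case by blast
  qed
  with assms(1) show ?thesis unfolding solvable_def by (meson le_trans)
qed

lemma solvable_trans:
  assumes "solvable G E C" "solvable G D E" "parcs G \<subseteq> pverts G \<times> pverts G"
  shows "solvable G D C"
proof -
  from assms(1) obtain F where F: "(pebbling_step G)\<^sup>*\<^sup>* C F" "\<forall>v\<in>pverts G. E v \<le> F v"
    unfolding solvable_def by blast
  from solvable_mono[OF assms(2,3)] F(2) have "solvable G D F" by blast
  with F(1) show ?thesis unfolding solvable_def by (meson rtranclp_trans)
qed

lemma solvable_cancel:
  assumes "C v \<ge> 1" "D v \<ge> 1" "solvable G (D(v := D v - 1)) (C(v := C v - 1))"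
  shows "solvable G D C"
proof -
  let ?d = "\<lambda>x. if x = v then 1 else 0 :: nat"
  have "solvable G (\<lambda>x. (D(v := D v - 1)) x + ?d x) (\<lambda>x. (C(v := C v - 1)) x + ?d x)"
    by (rule solvable_add[OF assms(3) solvable_if_le]) simp
  moreover have "(\<lambda>x. (D(v := D v - 1)) x + ?d x) = D" "(\<lambda>x. (C(v := C v - 1)) x + ?d x) = C"
    using assms(1,2) by (auto simp: fun_eq_iff)
  ultimately show ?thesis by simp
qed

lemma solvable_serve:
  assumes "(u, w) \<in> parcs G" "u \<noteq> w" "C u \<ge> 2" "D w \<ge> 1"
    and "solvable G (D(w := D w - 1)) (C(u := C u - 2))"
  shows "solvable G D C"
proof -
  have "solvable G (\<lambda>x. (D(w := D w - 1)) x + (if x = w then 1 else 0))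
      (\<lambda>x. (C(u := C u - 2)) x + (if x = u then 2 * 1 else 0))"
    by (rule solvable_add[OF assms(5) solvable_arc[OF assms(1,2)]])
  moreover have "(\<lambda>x. (D(w := D w - 1)) x + (if x = w then 1 else 0)) = D"
      "(\<lambda>x. (C(u := C u - 2)) x + (if x = u then 2 * 1 else 0)) = C"
    using assms(3,4) by (auto simp: fun_eq_iff)
  ultimately show ?thesis by simp
qed

text \<open>A demand of two at \<open>u\<close> pays for one unit at \<open>w\<close>. The lone
  pebble on \<open>u\<close> covers half of it, which leaves one unit demanded at
  \<open>u\<close>.\<close>

lemma solvable_transfer:
  assumes "(u, w) \<in> parcs G" "u \<noteq> w" "C u = 1" "D w \<ge> 1" "D u = 0"
    and "parcs G \<subseteq> pverts G \<times> pverts G"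
    and "solvable G (D(w := D w - 1, u := 1)) (C(u := 0))"
  shows "solvable G D C"
proof -
  let ?E = "D(w := D w - 1, u := 2)"
  have "solvable G ?E C"
    by (rule solvable_cancel[of _ u]) (use assms in simp_all)
  moreover have "solvable G D ?E"
    by (rule solvable_serve[of u w])
      (use assms in \<open>auto intro!: solvable_if_le\<close>)
  ultimately show ?thesis using assms(6) by (rule solvable_trans)
qed

section \<open>Path powers: subpaths and reflection\<close>

lemma pverts_path_power [simp]: "pverts (path_power n k) = {1..n}"
  by (simp add: path_power_def)

lemma parcs_path_power_iff:
  "(u, w) \<in> parcs (path_power n k) \<longleftrightarrow>
    u \<in> {1..n} \<and> w \<in> {1..n} \<and> u \<noteq> w \<and> u \<le> w + k \<and> w \<le> u + k"
  by (auto simp: path_power_def)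

lemma parcs_path_power_subset:
  "parcs (path_power n k) \<subseteq> pverts (path_power n k) \<times> pverts (path_power n k)"
  by (auto simp: path_power_def)

lemma solvable_path_power_extend:
  assumes "solvable (path_power m k) D C" "m \<le> n" "\<And>v. m < v \<Longrightarrow> v \<le> n \<Longrightarrow> D v = 0"
  shows "solvable (path_power n k) D C"
proof -
  have "pebbling_step (path_power n k) A B" if "pebbling_step (path_power m k) A B" for A B
    using that assms(2) unfolding pebbling_step_def parcs_path_power_iff by fastforce
  then have "(pebbling_step (path_power n k))\<^sup>*\<^sup>* A B"
    if "(pebbling_step (path_power m k))\<^sup>*\<^sup>* A B" for A B
    using that by (metis mono_rtranclp)
  moreover have "D v \<le> E v" if "\<forall>v\<in>{1..m}. D v \<le> E v" "v \<in> {1..n}" for E v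
    using that assms(3)[of v] by (cases "v \<le> m") auto
  ultimately show ?thesis using assms(1) unfolding solvable_def pverts_path_power by blast
qed

lemma solvable_path_power_reflect:
  assumes "solvable (path_power n k) (\<lambda>v. D (n + 1 - v)) (\<lambda>v. C (n + 1 - v))"
  shows "solvable (path_power n k) D C"
proof -
  have step: "pebbling_step (path_power n k) (\<lambda>v. A (n + 1 - v)) (\<lambda>v. B (n + 1 - v))"
    if AB: "pebbling_step (path_power n k) A B" for A B
  proof -
    from AB obtain u w where uw: "(u, w) \<in> parcs (path_power n k)" "A u \<ge> 2"
        "B = A(u := A u - 2, w := A w + 1)"
      unfolding pebbling_step_def by blast
    have "(n + 1 - u, n + 1 - w) \<in> parcs (path_power n k)"
      using uw(1) unfolding parcs_path_power_iff by auto
    moreover have "(\<lambda>v. B (n + 1 - v)) = (\<lambda>v. A (n + 1 - v))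
        (n + 1 - u := A (n + 1 - (n + 1 - u)) - 2, n + 1 - w := A (n + 1 - (n + 1 - w)) + 1)"
      using uw(1) unfolding uw(3) parcs_path_power_iff by (auto simp: fun_eq_iff)
    moreover have "A (n + 1 - (n + 1 - u)) \<ge> 2"
      using uw(1,2) unfolding parcs_path_power_iff by auto
    ultimately show ?thesis unfolding pebbling_step_def by blast
  qed
  have steps: "(pebbling_step (path_power n k))\<^sup>*\<^sup>* (\<lambda>v. A (n + 1 - v)) (\<lambda>v. B (n + 1 - v))"
    if "(pebbling_step (path_power n k))\<^sup>*\<^sup>* A B" for A B
    using that by (induction rule: rtranclp_induct) (simp, metis (no_types, lifting) rtranclp.rtrancl_into_rtrancl step)
  from assms obtain E where
    E: "(pebbling_step (path_power n k))\<^sup>*\<^sup>* (\<lambda>v. C (n + 1 - v)) E" "\<forall>v\<in>{1..n}. D (n + 1 - v) \<le> E v"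
    unfolding solvable_def by auto
  have le: "\<forall>v\<in>{1..n}. D v \<le> E (n + 1 - v)"
  proof
    fix v assume "v \<in> {1..n}"
    then have "n + 1 - v \<in> {1..n}" "n + 1 - (n + 1 - v) = v" by auto
    then show "D v \<le> E (n + 1 - v)" using E(2) by metis
  qed
  have "solvable (path_power n k) D (\<lambda>v. C (n + 1 - (n + 1 - v)))"
    unfolding solvable_def using steps[OF E(1)] le by auto
  \<comment> \<open>Truncated subtraction undoes the double reflection only up to
    \<open>n + 1\<close>; the values beyond are not on vertices.\<close>
  then show ?thesis
    by (rule solvable_mono[OF _ parcs_path_power_subset]) auto
qed

section \<open>Size, support and the subtraction-free inequality\<close>

abbreviation mass :: "nat \<Rightarrow> (nat \<Rightarrow> nat) \<Rightarrow> nat" where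
  "mass n D \<equiv> sum D {1..n}"

abbreviation spread :: "nat \<Rightarrow> (nat \<Rightarrow> nat) \<Rightarrow> nat" where
  "spread n D \<equiv> card {v \<in> {1..n}. 0 < D v}"

text \<open>The inequality \<open>|C| \<ge> f j - s(D) + 1\<close>, free of subtractions. Together with
  \<open>admissible\<close>, which is \<open>j \<le> d - 1\<close> for \<open>n \<ge> 2\<close>, it also makes sense for \<open>n = 1\<close>.\<close>

definition enough :: "nat \<Rightarrow> nat \<Rightarrow> (nat \<Rightarrow> nat) \<Rightarrow> (nat \<Rightarrow> nat) \<Rightarrow> nat \<Rightarrow> bool" where
  "enough n k D C j \<longleftrightarrow>
     mass n D * 2 ^ (j + 1) + n \<le> mass n C + spread n D + k * j + 1"

definition admissible :: "nat \<Rightarrow> nat \<Rightarrow> nat \<Rightarrow> bool" where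
  "admissible n k j \<longleftrightarrow> j = 0 \<or> k * j + 2 \<le> n"

lemma mass_upd:
  assumes "v \<in> {1..n}"
  shows "mass n (D(v := x)) + D v = mass n D + x"
proof -
  have "mass n (D(v := x)) = x + sum (D(v := x)) ({1..n} - {v})"
    using assms by (subst sum.remove[of _ v]) auto
  also have "sum (D(v := x)) ({1..n} - {v}) = sum D ({1..n} - {v})"
    by (rule sum.cong) auto
  finally show ?thesis using assms by (simp add: sum.remove[of "{Suc 0..n}" v D])
qed

lemma spread_upd_pos:
  assumes "v \<in> {1..n}" "0 < D v" "0 < x"
  shows "spread n (D(v := x)) = spread n D"
proof -
  have "{u \<in> {1..n}. 0 < (D(v := x)) u} = {u \<in> {1..n}. 0 < D u}" using assms by auto
  then show ?thesis by simp
qed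

lemma spread_upd_new:
  assumes "v \<in> {1..n}" "D v = 0" "0 < x"
  shows "spread n (D(v := x)) = spread n D + 1"
proof -
  have "{u \<in> {1..n}. 0 < (D(v := x)) u} = insert v {u \<in> {1..n}. 0 < D u}" using assms by auto
  then show ?thesis using assms by simp
qed

lemma spread_upd_zero:
  assumes "v \<in> {1..n}" "0 < D v"
  shows "spread n (D(v := 0)) + 1 = spread n D"
  using spread_upd_new[of v n "D(v := 0)" "D v"] assms by simp

lemma spread_upd_ge: "v \<in> {1..n} \<Longrightarrow> spread n D \<le> spread n (D(v := x)) + 1"
  using spread_upd_pos[of v n D x] spread_upd_new[of v n D x] spread_upd_zero[of v n D]
  by (cases "0 < D v"; cases "0 < x") (simp_all add: fun_upd_idem)

lemma spread_le_mass: "spread n D \<le> mass n D"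
proof -
  have "spread n D = (\<Sum>v\<in>{v \<in> {1..n}. 0 < D v}. 1)" by simp
  also have "\<dots> \<le> (\<Sum>v\<in>{v \<in> {1..n}. 0 < D v}. D v)" by (rule sum_mono) simp
  also have "\<dots> \<le> mass n D" by (rule sum_mono2) auto
  finally show ?thesis .
qed

lemma mass_reflect: "mass n (\<lambda>v. D (n + 1 - v)) = mass n D"
  by (rule sum.reindex_bij_witness[where i = "\<lambda>v. n + 1 - v" and j = "\<lambda>v. n + 1 - v"]) auto

lemma spread_reflect: "spread n (\<lambda>v. D (n + 1 - v)) = spread n D"
  by (rule bij_betw_same_card[where f = "\<lambda>v. n + 1 - v"],
      rule bij_betw_byWitness[where f' = "\<lambda>v. n + 1 - v"]) auto

lemma mass_extend:
  assumes "m \<le> n" "\<And>v. m < v \<Longrightarrow> v \<le> n \<Longrightarrow> D v = 0"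
  shows "mass m D = mass n D"
  by (rule sum.mono_neutral_left) (use assms in auto)

lemma spread_extend:
  assumes "m \<le> n" "\<And>v. m < v \<Longrightarrow> v \<le> n \<Longrightarrow> D v = 0"
  shows "spread m D = spread n D"
proof -
  have "v \<le> m" if "v \<le> n" "0 < D v" for v
    using assms(2)[of v] that by (cases "v \<le> m") auto
  then have "{v \<in> {1..m}. 0 < D v} = {v \<in> {1..n}. 0 < D v}"
    using assms(1) by auto
  then show ?thesis by simp
qed

text \<open>With \<open>a = 2 ^ j1\<close>, \<open>b = 2 ^ j2\<close>, \<open>t1 = p + 1\<close> and
  \<open>t2 = q + 1\<close>, half the difference of the two sides is
  \<open>p * a * (b - 1) + q * b * (a - 1) + (a - 1) * (b - 1)\<close>. The total
  \<open>t + 1\<close> arises because one unit of demand is counted in both parts of a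
  split.\<close>

lemma superadditive_powers:
  fixes t t1 t2 j1 j2 :: nat
  assumes "t1 + t2 = t + 1" "1 \<le> t1" "1 \<le> t2"
  shows "t1 * 2 ^ (j1 + 1) + t2 * 2 ^ (j2 + 1) \<le> t * 2 ^ (j1 + j2 + 1) + 2"
proof -
  define a b :: nat where "a = 2 ^ j1" and "b = 2 ^ j2"
  have "1 \<le> a" "1 \<le> b" by (simp_all add: a_def b_def)
  then obtain a' b' where ab: "a = a' + 1" "b = b' + 1" by (metis le_add_diff_inverse2)
  obtain p q where pq: "t1 = p + 1" "t2 = q + 1" using assms(2,3) by (metis le_add_diff_inverse2)
  with assms(1) have "t = p + q + 1" by simp
  then have "t1 * a + t2 * b \<le> t * (a * b) + 1"
    unfolding pq ab by (simp add: algebra_simps)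
  then show ?thesis by (simp add: a_def b_def power_add)
qed

section \<open>Passing the inequality to smaller instances\<close>

text \<open>The left side of the inequality drops by \<open>2 ^ (j + 1) \<ge> 2\<close>, the right
  side by at most two: one pebble and possibly one target.\<close>

lemma enough_cancel:
  assumes "enough n k D C j" "v \<in> {1..n}" "1 \<le> C v" "1 \<le> D v"
  shows "enough n k (D(v := D v - 1)) (C(v := C v - 1)) j"
proof -
  have "mass n (D(v := D v - 1)) + 1 = mass n D" "mass n (C(v := C v - 1)) + 1 = mass n C"
    using mass_upd[OF assms(2), of D "D v - 1"] mass_upd[OF assms(2), of C "C v - 1"] assms(3,4)
    by linarith+
  moreover have "spread n D \<le> spread n (D(v := D v - 1)) + 1"
    by (rule spread_upd_ge) (rule assms)
  moreover have "(2::nat) \<le> 2 ^ (j + 1)" by simp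
  moreover have "mass n D * 2 ^ (j + 1)
      = mass n (D(v := D v - 1)) * 2 ^ (j + 1) + 2 ^ (j + 1)"
    unfolding calculation(1)[symmetric] by simp
  ultimately show ?thesis using assms(1) unfolding enough_def by linarith
qed

text \<open>Serving a target of demand 1 loses one unit of \<open>s(D)\<close> besides two pebbles, which only the
  inequalities with \<open>j > 0\<close> can afford.\<close>

lemma enough_serve_pos:
  assumes "enough n k D C (Suc j)" "u \<in> {1..n}" "v \<in> {1..n}" "2 \<le> C u" "1 \<le> D v"
  shows "enough n k (D(v := D v - 1)) (C(u := C u - 2)) (Suc j)"
proof -
  have "mass n (D(v := D v - 1)) + 1 = mass n D" "mass n (C(u := C u - 2)) + 2 = mass n C"
    using mass_upd[OF assms(3), of D "D v - 1"] mass_upd[OF assms(2), of C "C u - 2"] assms(4,5)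
    by linarith+
  moreover have "spread n D \<le> spread n (D(v := D v - 1)) + 1"
    by (rule spread_upd_ge) (rule assms)
  moreover have "(4::nat) \<le> 2 ^ (Suc j + 1)" by simp
  moreover have "mass n D * 2 ^ (Suc j + 1)
      = mass n (D(v := D v - 1)) * 2 ^ (Suc j + 1) + 2 ^ (Suc j + 1)"
    unfolding calculation(1)[symmetric] by simp
  ultimately show ?thesis using assms(1) unfolding enough_def by linarith
qed

text \<open>Since \<open>v\<close> remains a target, the right side loses only the two pebbles,
  which every \<open>j\<close> can afford.\<close>

lemma enough_serve_multi:
  assumes "enough n k D C j" "u \<in> {1..n}" "v \<in> {1..n}" "2 \<le> C u" "2 \<le> D v"
  shows "enough n k (D(v := D v - 1)) (C(u := C u - 2)) j"
proof -
  have "mass n (D(v := D v - 1)) + 1 = mass n D" "mass n (C(u := C u - 2)) + 2 = mass n C"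
    using mass_upd[OF assms(3), of D "D v - 1"] mass_upd[OF assms(2), of C "C u - 2"] assms(4,5)
    by linarith+
  moreover have "spread n (D(v := D v - 1)) = spread n D"
    by (rule spread_upd_pos) (use assms in auto)
  moreover have "(2::nat) \<le> 2 ^ (j + 1)" by simp
  moreover have "mass n D * 2 ^ (j + 1)
      = mass n (D(v := D v - 1)) * 2 ^ (j + 1) + 2 ^ (j + 1)"
    unfolding calculation(1)[symmetric] by simp
  ultimately show ?thesis using assms(1) unfolding enough_def by linarith
qed

text \<open>The right side loses three: two pebbles and a target. The left side loses at least two
  from the demand and one more by dropping the vertex \<open>n\<close>.\<close>

lemma enough_serve_top:
  assumes "enough n k D C j" "u \<in> {1..n}" "u \<noteq> n" "2 \<le> C u" "D n = 1" "C n = 0"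
  shows "enough (n - 1) k (D(n := 0)) (C(u := C u - 2)) j"
proof -
  have n: "n \<in> {1..n}" "1 \<le> n" using assms(2) by auto
  have "mass n (D(n := 0)) + 1 = mass n D" "mass n (C(u := C u - 2)) + 2 = mass n C"
    using mass_upd[OF n(1), of D 0] mass_upd[OF assms(2), of C "C u - 2"] assms(4,5)
    by linarith+
  moreover have ext: "mass (n - 1) (D(n := 0)) = mass n (D(n := 0))"
      "mass (n - 1) (C(u := C u - 2)) = mass n (C(u := C u - 2))"
    by (rule mass_extend; use assms in \<open>auto simp: le_less\<close>)+
  moreover have "spread n (D(n := 0)) + 1 = spread n D"
    by (rule spread_upd_zero) (use assms n in auto)
  moreover have ext': "spread (n - 1) (D(n := 0)) = spread n (D(n := 0))"
    by (rule spread_extend) (auto simp: le_less)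
  moreover have "(2::nat) \<le> 2 ^ (j + 1)" by simp
  moreover have "mass n D * 2 ^ (j + 1) = mass n (D(n := 0)) * 2 ^ (j + 1) + 2 ^ (j + 1)"
    unfolding calculation(1)[symmetric] by simp
  ultimately show ?thesis
    using assms(1) n(2) unfolding enough_def ext ext' by linarith
qed

text \<open>The demand keeps its size, and the new target \<open>u\<close> makes up for the pebble
  given away.\<close>

lemma enough_transfer_multi:
  assumes "enough n k D C j" "u \<in> {1..n}" "v \<in> {1..n}" "u \<noteq> v" "C u = 1" "D u = 0" "2 \<le> D v"
  shows "enough n k (D(v := D v - 1, u := 1)) (C(u := 0)) j"
proof -
  let ?D = "D(v := D v - 1)"
  have "mass n ?D + 1 = mass n D" "mass n (C(u := 0)) + 1 = mass n C"
    using mass_upd[OF assms(3), of D "D v - 1"] mass_upd[OF assms(2), of C 0] assms(5,7)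
    by linarith+
  moreover have "mass n (?D(u := 1)) = mass n ?D + 1"
    using mass_upd[OF assms(2), of ?D 1] assms by simp
  moreover have "spread n ?D = spread n D"
    by (rule spread_upd_pos) (use assms in auto)
  moreover have "spread n (?D(u := 1)) = spread n ?D + 1"
    by (rule spread_upd_new) (use assms in auto)
  ultimately show ?thesis using assms(1) unfolding enough_def by simp
qed

text \<open>The target moves from \<open>n\<close> to \<open>u\<close>, so size and support of the
  demand are unchanged; dropping the vertex \<open>n\<close> pays for the lost pebble.\<close>

lemma enough_transfer_top:
  assumes "enough n k D C j" "u \<in> {1..n}" "u \<noteq> n" "C u = 1" "D u = 0" "D n = 1" "C n = 0"
  shows "enough (n - 1) k (D(n := 0, u := 1)) (C(u := 0)) j"
proof -
  let ?D = "D(n := 0)"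
  have n: "n \<in> {1..n}" "1 \<le> n" using assms(2) by auto
  have "mass n ?D + 1 = mass n D" "mass n (C(u := 0)) + 1 = mass n C"
    using mass_upd[OF n(1), of D 0] mass_upd[OF assms(2), of C 0] assms(4,6)
    by linarith+
  moreover have "mass n (?D(u := 1)) = mass n ?D + 1"
    using mass_upd[OF assms(2), of ?D 1] assms by simp
  moreover have "mass (n - 1) (?D(u := 1)) = mass n (?D(u := 1))"
      "mass (n - 1) (C(u := 0)) = mass n (C(u := 0))"
    by (rule mass_extend; use assms in \<open>auto simp: le_less\<close>)+
  moreover have "spread n ?D + 1 = spread n D"
    by (rule spread_upd_zero) (use assms n in auto)
  moreover have "spread n (?D(u := 1)) = spread n ?D + 1"
    by (rule spread_upd_new) (use assms in auto)
  moreover have "spread (n - 1) (?D(u := 1)) = spread n (?D(u := 1))"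
    by (rule spread_extend) (use assms in \<open>auto simp: le_less\<close>)
  ultimately show ?thesis using assms(1) n(2) unfolding enough_def by simp
qed

section \<open>Empty window below a demanded end vertex\<close>

lemma solvable_path_power_shift:
  assumes "k < n" "\<And>x. x \<in> {1..n} \<Longrightarrow> n - k < x \<Longrightarrow> x \<le> k \<Longrightarrow> D x = 0"
  shows "solvable (path_power n k) D (\<lambda>v. (if v \<le> n - k then D v else 0) +
      (if n - k < v + k \<and> v \<in> {1..n - k} then 2 * D (v + k) else 0))"
proof (cases "k = 0")
  case True
  then show ?thesis by (intro solvable_if_le) auto
next
  case False
  define X where "X = {x \<in> {1..n}. n - k < x \<and> k < x}"
  have "finite X" by (simp add: X_def)
  have "solvable (path_power n k) (\<lambda>v. \<Sum>x\<in>X. if v = x then D x else 0)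
      (\<lambda>v. \<Sum>x\<in>X. if v = x - k then 2 * D x else 0)"
    by (rule solvable_sum[OF \<open>finite X\<close>], rule solvable_arc)
      (use False in \<open>auto simp: parcs_path_power_iff X_def\<close>)
  moreover have "(\<lambda>v. \<Sum>x\<in>X. if v = x then D x else 0) = (\<lambda>v. if v \<in> X then D v else 0)"
    using \<open>finite X\<close> by simp
  moreover have "(\<Sum>x\<in>X. if v = x - k then 2 * D x else 0) = (if v + k \<in> X then 2 * D (v + k) else 0)"
    for v
  proof -
    have "(\<Sum>x\<in>X. if v = x - k then 2 * D x else 0) = (\<Sum>x\<in>X. if v + k = x then 2 * D x else 0)"
      by (rule sum.cong) (auto simp: X_def)
    then show ?thesis using \<open>finite X\<close> by simp
  qed
  ultimately have "solvable (path_power n k) (\<lambda>v. if v \<in> X then D v else 0)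
      (\<lambda>v. if v + k \<in> X then 2 * D (v + k) else 0)"
    by simp
  from solvable_add[OF solvable_if_le this, of "\<lambda>v. if v \<le> n - k then D v else 0"
      "\<lambda>v. if v \<le> n - k then D v else 0"]
  have *: "solvable (path_power n k)
      (\<lambda>v. (if v \<le> n - k then D v else 0) + (if v \<in> X then D v else 0))
      (\<lambda>v. (if v \<le> n - k then D v else 0) + (if v + k \<in> X then 2 * D (v + k) else 0))"
    by simp
  have "solvable (path_power n k)
      (\<lambda>v. (if v \<le> n - k then D v else 0) + (if v \<in> X then D v else 0))
      (\<lambda>v. (if v \<le> n - k then D v else 0) +
        (if n - k < v + k \<and> v \<in> {1..n - k} then 2 * D (v + k) else 0))"
    by (rule solvable_mono[OF * parcs_path_power_subset]) (auto simp: X_def)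
  moreover have "D v \<le> (if v \<le> n - k then D v else 0) + (if v \<in> X then D v else 0)"
    if "v \<in> {1..n}" for v
    using that assms(2)[of v] by (auto simp: X_def)
  ultimately show ?thesis unfolding solvable_def pverts_path_power by (meson le_trans)
qed

text \<open>In the shift, targets \<open>x \<le> k\<close> have no vertex \<open>x - k\<close> to go to. They occur only if \<open>n < 2 * k\<close>;
  then they are adjacent to all pebbles and are served first.\<close>

lemma solvable_void_top:
  assumes IH: "\<And>D C. (\<And>j. admissible (n - k) k j \<Longrightarrow> enough (n - k) k D C j) \<Longrightarrow>
      solvable (path_power (n - k) k) D C"
    and "1 \<le> k" "k + 2 \<le> n"
    and "\<And>v. v \<in> {n - k..n} \<Longrightarrow> C v = 0"
    and "\<And>j. k * Suc j + 2 \<le> n \<Longrightarrow> enough n k D C (Suc j)"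
  shows "solvable (path_power n k) D C"
  using assms(4-5)
proof (induction "mass n C" arbitrary: C D rule: less_induct)
  case less
  note void = less.prems(1) and en = less.prems(2)
  show ?case
  \<comment> \<open>As long as a pile of two is adjacent to a target, it serves that target; the
    inequalities with positive index survive and \<open>C\<close> shrinks.\<close>
  proof (cases "\<exists>u v. (u, v) \<in> parcs (path_power n k) \<and> 2 \<le> C u \<and> 1 \<le> D v")
    case True
    then obtain u v where uv: "(u, v) \<in> parcs (path_power n k)" "2 \<le> C u" "1 \<le> D v" by blast
    then have uv': "u \<in> {1..n}" "v \<in> {1..n}" "u \<noteq> v" by (simp_all add: parcs_path_power_iff)
    have "mass n (C(u := C u - 2)) < mass n C"
      using mass_upd[OF uv'(1), of C "C u - 2"] uv by linarith
    then have "solvable (path_power n k) (D(v := D v - 1)) (C(u := C u - 2))"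
    proof (rule less.hyps)
      show "(C(u := C u - 2)) x = 0" if "x \<in> {n - k..n}" for x
        using void[OF that] by auto
    qed (intro enough_serve_pos en uv uv')
    then show ?thesis by (rule solvable_serve[where C = C and D = D, OF uv(1) uv'(3) uv(2,3)])
  next
    case False
    \<comment> \<open>Such an \<open>x\<close> is adjacent to every vertex below
      \<open>n - k\<close>, so all piles have at most one pebble and
      \<open>mass n C \<le> n - k - 1\<close>. The inequality of index 1 then gives
      \<open>4 * mass n D \<le> spread n D\<close>, which is absurd.\<close>
    have low: "D x = 0" if x: "x \<in> {1..n}" "n - k < x" "x \<le> k" for x
    proof (rule ccontr)
      assume "D x \<noteq> 0"
      have "C u \<le> 1" if "u \<in> {1..n - k - 1}" for u
      proof (rule ccontr)
        assume "\<not> C u \<le> 1"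
        moreover have "(u, x) \<in> parcs (path_power n k)"
          using that x by (auto simp: parcs_path_power_iff)
        ultimately show False using False \<open>D x \<noteq> 0\<close> by force
      qed
      then have "sum C {1..n - k - 1} \<le> sum (\<lambda>_. 1) {1..n - k - 1}" by (rule sum_mono)
      moreover have "mass n C = sum C {1..n - k - 1}"
        by (rule sum.mono_neutral_right) (use void in auto)
      ultimately have "mass n C \<le> n - k - 1" by simp
      moreover have "mass n D * 4 + n \<le> mass n C + spread n D + k + 1"
        using en[of 0] \<open>k + 2 \<le> n\<close> by (simp add: enough_def)
      moreover have "D x \<le> mass n D" using x by (intro member_le_sum) auto
      ultimately show False using spread_le_mass[of n D] \<open>D x \<noteq> 0\<close> \<open>k + 2 \<le> n\<close> by linarith
    qed
    define E where "E v = (if v \<le> n - k then D v else 0) +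
      (if n - k < v + k \<and> v \<in> {1..n - k} then 2 * D (v + k) else 0)" for v
    have DE: "solvable (path_power n k) D E"
      unfolding E_def by (rule solvable_path_power_shift) (use low \<open>k + 2 \<le> n\<close> in auto)
    have "solvable (path_power n k) E C"
    proof (rule solvable_path_power_extend)
      show "solvable (path_power (n - k) k) E C"
      proof (rule IH)
        fix j assume j: "admissible (n - k) k j"
        then have "k * Suc j + 2 \<le> n" using \<open>k + 2 \<le> n\<close> by (auto simp: admissible_def)
        from en[OF this] have en': "mass n D * 2 ^ (j + 2) + n
            \<le> mass n C + spread n D + k * j + k + 1"
          by (simp add: enough_def)
        define T where "T = (\<Sum>x\<in>{n - k<..n}. D x)"
        define X where "X = {x \<in> {1..n}. n - k < x \<and> k < x}"
        have t: "mass n D = mass (n - k) D + T"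
        proof -
          have "{1..n} = {1..n - k} \<union> {n - k<..n}" by auto
          then show ?thesis unfolding T_def by (simp only:) (rule sum.union_disjoint, auto)
        qed
        have "T = sum D X" unfolding T_def
        proof (rule sum.mono_neutral_right)
          show "\<forall>x\<in>{n - k<..n} - X. D x = 0"
          proof
            fix x assume "x \<in> {n - k<..n} - X"
            then show "D x = 0" by (intro low) (auto simp: X_def)
          qed
        qed (auto simp: X_def)
        also have "\<dots> = (\<Sum>v\<in>{v \<in> {1..n - k}. n - k < v + k}. D (v + k))"
          by (rule sum.reindex_bij_witness[where i = "\<lambda>v. v + k" and j = "\<lambda>x. x - k"])
            (auto simp: X_def)
        also have "\<dots> = (\<Sum>v\<in>{1..n - k}. if n - k < v + k then D (v + k) else 0)"
          by (rule sum.inter_filter) simp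
        finally have T: "T = (\<Sum>v\<in>{1..n - k}. if n - k < v + k then D (v + k) else 0)" .
        have "mass (n - k) E = (\<Sum>v\<in>{1..n - k}. D v + 2 * (if n - k < v + k then D (v + k) else 0))"
          by (rule sum.cong) (auto simp: E_def)
        also have "\<dots> = mass (n - k) D + 2 * T"
          unfolding T by (simp only: sum.distrib sum_distrib_left)
        finally have tE: "mass (n - k) E = mass (n - k) D + 2 * T" .
        \<comment> \<open>Targets \<open>v\<close> and \<open>v + k\<close> may merge in
          \<open>E\<close>, so its support can be smaller. Only the shifted targets are counted in
          \<open>E\<close>; the unshifted ones are paid for by the surplus
          \<open>mass (n - k) D * 2 ^ (j + 1)\<close>, which exists because their demand is not
          doubled.\<close>
        have "{v \<in> {1..n}. 0 < D v} = {v \<in> {1..n - k}. 0 < D v} \<union> {x \<in> X. 0 < D x}"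
          using low by (force simp: X_def)
        then have "spread n D \<le> spread (n - k) D + card {x \<in> X. 0 < D x}"
          by (simp add: card_Un_le)
        moreover have "card {x \<in> X. 0 < D x} \<le> spread (n - k) E"
          by (rule card_inj_on_le[where f = "\<lambda>x. x - k"])
            (auto simp: X_def E_def inj_on_def)
        moreover have "spread (n - k) D \<le> mass (n - k) D" by (rule spread_le_mass)
        moreover have "mass (n - k) D \<le> mass (n - k) D * 2 ^ (j + 1)" by simp
        moreover have "mass n D * 2 ^ (j + 2)
            = mass (n - k) E * 2 ^ (j + 1) + mass (n - k) D * 2 ^ (j + 1)"
          unfolding t tE by (simp add: algebra_simps)
        moreover have "mass (n - k) C = mass n C"
          by (rule sum.mono_neutral_left) (use void in auto)
        ultimately show "enough (n - k) k E C j"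
          unfolding enough_def using en' \<open>k + 2 \<le> n\<close> by linarith
      qed
    qed (auto simp: E_def)
    then show ?thesis by (rule solvable_trans[OF _ DE parcs_path_power_subset])
  qed
qed

section \<open>Splitting the demand at an interior target\<close>

text \<open>Take the largest initial part of the demand that the left can serve. If the right cannot
  serve the rest, then one more unit on the left and the rest on the right both violate their
  inequalities, and the sum of the violations contradicts the hypothesis.\<close>

lemma solvable_split:
  assumes IH: "\<And>m D C. m < n \<Longrightarrow> (\<And>j. admissible m k j \<Longrightarrow> enough m k D C j) \<Longrightarrow>
      solvable (path_power m k) D C"
    and "2 \<le> n" "D 1 = 0" "D n = 0"
    and disj: "\<And>v. v \<in> {1..n} \<Longrightarrow> 0 < D v \<Longrightarrow> C v = 0"
    and en: "\<And>j. admissible n k j \<Longrightarrow> enough n k D C j"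
  shows "solvable (path_power n k) D C"
proof -
  \<comment> \<open>\<open>D1\<close> is an initial part of the demand, ending at \<open>y\<close>, that \<open>{1..y}\<close> can serve on its own.\<close>
  define P where "P D1 y \<longleftrightarrow> y \<in> {1..<n} \<and> (\<forall>v. D1 v \<le> D v) \<and> (\<forall>v>y. D1 v = 0) \<and>
      (\<forall>v\<in>{1..<y}. D1 v = D v) \<and>
      ((\<forall>v. D1 v = 0) \<or> (\<forall>j. admissible y k j \<longrightarrow> enough y k D1 C j))" for D1 y
  have "P (\<lambda>_. 0) 1" using \<open>2 \<le> n\<close> by (auto simp: P_def)
  moreover have "mass n D1 < mass n D + 1" if "P D1 y" for D1 y
  proof -
    have "mass n D1 \<le> mass n D" using that by (intro sum_mono) (auto simp: P_def)
    then show ?thesis by simp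
  qed
  ultimately obtain D1 y where P: "P D1 y"
    and max: "\<And>D1' y'. P D1' y' \<Longrightarrow> mass n D1' \<le> mass n D1"
    using ex_has_greatest_nat[of "\<lambda>(D1, y). P D1 y" "(\<lambda>_. 0, 1)" "\<lambda>(D1, y). mass n D1"
        "mass n D + 1"]
    by auto blast
  define CL where "CL v = (if v \<le> y then C v else 0)" for v
  have y: "y \<in> {1..<n}" using P by (simp add: P_def)
  have solv1: "solvable (path_power n k) D1 CL"
  proof (cases "\<forall>v. D1 v = 0")
    case True
    then show ?thesis by (intro solvable_if_le) simp
  next
    case False
    have "mass y CL = mass y C" by (rule sum.cong) (auto simp: CL_def)
    then have "enough y k D1 CL j" if "admissible y k j" for j
      using that False P by (auto simp: P_def enough_def)
    then have "solvable (path_power y k) D1 CL" using y by (intro IH) auto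
    then show ?thesis by (rule solvable_path_power_extend) (use y P in \<open>auto simp: P_def\<close>)
  qed
  define D2 where "D2 v = (if v \<in> {1..n} then D v - D1 v else 0)" for v
  show ?thesis
  proof (cases "\<forall>v. D2 v = 0")
    case True
    have "solvable (path_power n k) D1 C"
      by (rule solvable_mono[OF solv1 parcs_path_power_subset]) (auto simp: CL_def)
    then show ?thesis
      by (rule solvable_mono_target) (use True in \<open>auto simp: D2_def split: if_splits\<close>)
  next
    case False
    \<comment> \<open>The first target not fully covered by \<open>D1\<close> is where the path is
      cut.\<close>
    define z where "z = (LEAST v. 0 < D2 v)"
    have "0 < D2 z" using False unfolding z_def by (metis LeastI neq0_conv)
    have below: "D2 v = 0" if "v < z" for v using that not_less_Least unfolding z_def by blast
    have z: "z \<in> {1..n}" "D1 z < D z"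
      using \<open>0 < D2 z\<close> by (auto simp: D2_def split: if_splits)
    then have "z \<noteq> 1" "z \<noteq> n" using assms(3,4) by auto
    with z have z': "z \<in> {2..<n}" by auto
    have "y \<le> z"
    proof (rule ccontr)
      assume "\<not> y \<le> z"
      then have "D1 z = D z" using P z by (auto simp: P_def)
      with z show False by simp
    qed
    have "C z = 0" using disj z by auto
    have low: "D1 v = D v" if "v \<in> {1..<z}" for v
    proof -
      have "D v - D1 v = 0" using below[of v] that z by (auto simp: D2_def)
      moreover have "D1 v \<le> D v" using P by (simp add: P_def)
      ultimately show ?thesis by simp
    qed
    define CR where "CR v = (if z \<le> v \<and> v \<le> n then C v else 0)" for v
    define m where "m = n + 1 - z"
    have m: "m < n" "m \<le> n" using z' by (auto simp: m_def)
    \<comment> \<open>Reflection carries \<open>{z..n}\<close> to \<open>{1..m}\<close>, a shorter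
      path to which the induction hypothesis applies.\<close>
    let ?D2 = "\<lambda>v. D2 (n + 1 - v)" and ?CR = "\<lambda>v. CR (n + 1 - v)"
    have D2_out: "?D2 v = 0" if "m < v" for v
      using that z by (intro below) (auto simp: m_def)
    have CR_out: "?CR v = 0" if "m < v" for v
      using that z by (auto simp: m_def CR_def)
    show ?thesis
    proof (cases "\<forall>j. admissible m k j \<longrightarrow> enough m k ?D2 ?CR j")
      case True
      then have "solvable (path_power m k) ?D2 ?CR" using m by (intro IH) auto
      then have "solvable (path_power n k) ?D2 ?CR"
        by (rule solvable_path_power_extend) (use m D2_out in auto)
      then have "solvable (path_power n k) D2 CR" by (rule solvable_path_power_reflect)
      with solv1 have "solvable (path_power n k) (\<lambda>v. D1 v + D2 v) (\<lambda>v. CL v + CR v)"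
        by (rule solvable_add)
      \<comment> \<open>The two sides can overlap only at \<open>y = z\<close>, where
        \<open>C\<close> vanishes, so no pebble is used twice.\<close>
      then have "solvable (path_power n k) (\<lambda>v. D1 v + D2 v) C"
        by (rule solvable_mono[OF _ parcs_path_power_subset])
          (use \<open>y \<le> z\<close> \<open>C z = 0\<close> in \<open>auto simp: CL_def CR_def dest: le_antisym\<close>)
      then show ?thesis
        by (rule solvable_mono_target) (auto simp: D2_def)
    next
      case False
      then obtain j2 where j2: "admissible m k j2" "\<not> enough m k ?D2 ?CR j2" by blast
      \<comment> \<open>One more unit at \<open>z\<close> respects all other clauses of
        \<open>P\<close> with end \<open>z\<close>, so by maximality of \<open>D1\<close> only the
        inequality can fail.\<close>
      let ?D1 = "D1(z := D1 z + 1)"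
      have "mass n ?D1 = mass n D1 + 1" using mass_upd[OF z(1), of D1 "D1 z + 1"] by linarith
      then have "\<not> P ?D1 z" using max[of ?D1 z] by linarith
      moreover have out1: "?D1 v = 0" if "z < v" for v
        using that P \<open>y \<le> z\<close> by (auto simp: P_def)
      moreover have "?D1 v \<le> D v" for v using P z by (auto simp: P_def)
      ultimately obtain j1 where j1: "admissible z k j1" "\<not> enough z k ?D1 C j1"
        using z' low unfolding P_def by (auto simp del: fun_upd_apply simp: fun_upd_other)
      have t1: "mass z ?D1 = mass n D1 + 1"
        unfolding \<open>mass n ?D1 = mass n D1 + 1\<close>[symmetric]
        by (rule mass_extend) (use z out1 in auto)
      have t2: "mass m ?D2 = mass n D2"
        unfolding mass_reflect[where n = n and D = D2, symmetric]
        by (rule mass_extend) (use m D2_out in auto)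
      have "mass n D = mass n (\<lambda>v. D1 v + D2 v)"
        by (rule sum.cong) (use P in \<open>auto simp: D2_def P_def\<close>)
      then have t: "mass z ?D1 + mass m ?D2 = mass n D + 1" unfolding t1 t2 by (simp add: sum.distrib)
      have "0 < mass m ?D2"
        unfolding t2 using \<open>0 < D2 z\<close> z by (intro sum_pos2[of _ z]) auto
      have s1: "spread z ?D1 = spread n ?D1" by (rule spread_extend) (use z out1 in auto)
      have s2: "spread m ?D2 = spread n D2"
        unfolding spread_reflect[where n = n and D = D2, symmetric]
        by (rule spread_extend) (use m D2_out in auto)
      let ?A = "{v \<in> {1..n}. 0 < ?D1 v}" and ?B = "{v \<in> {1..n}. 0 < D2 v}"
      have "{v \<in> {1..n}. 0 < D v} \<subseteq> ?A \<union> ?B" by (auto simp: D2_def)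
      then have "spread n D \<le> card (?A \<union> ?B)" by (intro card_mono) auto
      moreover have "card {z} \<le> card (?A \<inter> ?B)"
        by (rule card_mono) (use z \<open>0 < D2 z\<close> in auto)
      moreover have "card ?A + card ?B = card (?A \<union> ?B) + card (?A \<inter> ?B)"
        by (rule card_Un_Int) auto
      ultimately have s: "spread n D + 1 \<le> spread z ?D1 + spread m ?D2" unfolding s1 s2 by simp
      have c2: "mass m ?CR = mass n CR"
        unfolding mass_reflect[where n = n and D = CR, symmetric]
        by (rule mass_extend) (use m CR_out in auto)
      have "mass z C = mass z (\<lambda>v. if v \<le> z then C v else 0)" by (rule sum.cong) auto
      also have "\<dots> = mass n (\<lambda>v. if v \<le> z then C v else 0)"
        by (rule mass_extend) (use z in auto)
      finally have "mass z C + mass m ?CR = mass n (\<lambda>v. (if v \<le> z then C v else 0) + CR v)"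
        unfolding c2 by (simp add: sum.distrib)
      also have "\<dots> = mass n C"
        by (rule sum.cong) (use \<open>C z = 0\<close> in \<open>auto simp: CR_def\<close>)
      finally have c: "mass z C + mass m ?CR = mass n C" .
      have "admissible n k (j1 + j2)"
        using j1(1) j2(1) z' by (auto simp: admissible_def m_def algebra_simps)
      \<comment> \<open>Adding the two failures gains 2 by strictness, 1 from the constant of
        \<open>enough\<close> occurring twice and 1 from \<open>z\<close> being a target of both
        parts. The losses are 1 from \<open>z + m = n + 1\<close> and 2 from
        \<open>superadditive_powers\<close>, so the hypothesis for \<open>j1 + j2\<close> fails by
        one.\<close>
      from en[OF this] have "mass n D * 2 ^ (j1 + j2 + 1) + n
          \<le> mass n C + spread n D + k * j1 + k * j2 + 1"
        by (simp add: enough_def algebra_simps)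
      moreover have "mass z ?D1 * 2 ^ (j1 + 1) + mass m ?D2 * 2 ^ (j2 + 1)
          \<le> mass n D * 2 ^ (j1 + j2 + 1) + 2"
        by (rule superadditive_powers) (use t t1 \<open>0 < mass m ?D2\<close> in auto)
      moreover have "mass z ?D1 * 2 ^ (j1 + 1) + z > mass z C + spread z ?D1 + k * j1 + 1"
        "mass m ?D2 * 2 ^ (j2 + 1) + m > mass m ?CR + spread m ?D2 + k * j2 + 1"
        using j1(2) j2(2) by (simp_all add: enough_def)
      moreover have "z + m = n + 1" using z by (simp add: m_def)
      ultimately have False using s c by linarith
      then show ?thesis ..
    qed
  qed
qed

section \<open>Serving a demanded end vertex\<close>

text \<open>When the last unit at \<open>n\<close> is served or moved, the vertex \<open>n\<close>
  is dropped and \<open>IH\<close> applies; while demand remains there, the path is kept and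
  \<open>IH'\<close> applies with fewer pebbles.\<close>

lemma solvable_top:
  assumes IH: "\<And>m D C. m < n \<Longrightarrow> (\<And>j. admissible m k j \<Longrightarrow> enough m k D C j) \<Longrightarrow>
      solvable (path_power m k) D C"
    and IH': "\<And>D' C'. mass n C' < mass n C \<Longrightarrow>
      (\<And>j. admissible n k j \<Longrightarrow> enough n k D' C' j) \<Longrightarrow> solvable (path_power n k) D' C'"
    and "1 \<le> k" "1 \<le> n" "0 < D n"
    and disj: "\<And>v. v \<in> {1..n} \<Longrightarrow> 0 < D v \<Longrightarrow> C v = 0"
    and en: "\<And>j. admissible n k j \<Longrightarrow> enough n k D C j"
  shows "solvable (path_power n k) D C"
proof -
  have "C n = 0" using disj[of n] assms(4,5) by simp
  have adm: "admissible n k j" if "admissible (n - 1) k j" for j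
    using that by (auto simp: admissible_def)
  show ?thesis
  proof (cases "\<exists>u\<in>{1..<n}. n - k \<le> u \<and> 0 < C u")
    case True
    then obtain u where u: "u \<in> {1..<n}" "n - k \<le> u" "0 < C u" by blast
    have un: "u \<in> {1..n}" "u \<noteq> n" "n \<in> {1..n}" using u by auto
    have "D u = 0" using disj[of u] u by auto
    have arc: "(u, n) \<in> parcs (path_power n k)" using u by (auto simp: parcs_path_power_iff)
    show ?thesis
    proof (cases "C u = 1")
      case True
      have "solvable (path_power n k) (D(n := D n - 1, u := 1)) (C(u := 0))"
      proof (cases "D n = 1")
        case True
        have "solvable (path_power (n - 1) k) (D(n := 0, u := 1)) (C(u := 0))"
          using assms(4) un \<open>C u = 1\<close> \<open>D u = 0\<close> True \<open>C n = 0\<close>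
          by (intro IH enough_transfer_top en adm) simp_all
        then have "solvable (path_power n k) (D(n := 0, u := 1)) (C(u := 0))"
          by (rule solvable_path_power_extend) (use u in auto)
        with True show ?thesis by simp
      next
        case False
        have "mass n (C(u := 0)) < mass n C"
          using mass_upd[OF un(1), of C 0] True by linarith
        then show ?thesis
          using un \<open>C u = 1\<close> \<open>D u = 0\<close> False \<open>0 < D n\<close>
          by (intro IH' enough_transfer_multi en) simp_all
      qed
      then show ?thesis
        by (rule solvable_transfer[where u = u and w = n, rotated -1])
          (use arc un True \<open>D u = 0\<close> \<open>0 < D n\<close> parcs_path_power_subset in simp_all)
    next
      case False
      with u have "2 \<le> C u" by simp
      have "solvable (path_power n k) (D(n := D n - 1)) (C(u := C u - 2))"
      proof (cases "D n = 1")
        case True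
        have "solvable (path_power (n - 1) k) (D(n := 0)) (C(u := C u - 2))"
          using assms(4) un \<open>2 \<le> C u\<close> True \<open>C n = 0\<close>
          by (intro IH enough_serve_top en adm) simp_all
        then have "solvable (path_power n k) (D(n := 0)) (C(u := C u - 2))"
          by (rule solvable_path_power_extend) (use u in auto)
        with True show ?thesis by simp
      next
        case False
        have "mass n (C(u := C u - 2)) < mass n C"
          using mass_upd[OF un(1), of C "C u - 2"] \<open>2 \<le> C u\<close> by linarith
        then show ?thesis
          using un \<open>2 \<le> C u\<close> False \<open>0 < D n\<close>
          by (intro IH' enough_serve_multi en) simp_all
      qed
      then show ?thesis
        by (rule solvable_serve[where u = u and w = n, rotated -1])
          (use arc un \<open>2 \<le> C u\<close> \<open>0 < D n\<close> in simp_all)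
    qed
  next
    case False
    have void: "C v = 0" if "v \<in> {1..n}" "n - k \<le> v" for v
      using that False \<open>C n = 0\<close> by (cases "v = n") auto
    have "D n \<le> mass n D" using \<open>1 \<le> n\<close> by (intro member_le_sum) auto
    show ?thesis
    proof (cases "k + 2 \<le> n")
      case True
      show ?thesis
      proof (rule solvable_void_top)
        show "solvable (path_power (n - k) k) D' C'"
          if "\<And>j. admissible (n - k) k j \<Longrightarrow> enough (n - k) k D' C' j" for D' C'
          by (rule IH[OF _ that]) (use \<open>1 \<le> k\<close> \<open>1 \<le> n\<close> in simp_all)
        show "enough n k D C (Suc j)" if "k * Suc j + 2 \<le> n" for j
          by (rule en) (use that in \<open>simp add: admissible_def\<close>)
        show "C v = 0" if "v \<in> {n - k..n}" for v
          by (rule void) (use that True in auto)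
      qed fact+
    next
      case small: False
      \<comment> \<open>Here \<open>n - k \<le> 1\<close>, so the window is the whole path and there
        are no pebbles; the inequality for \<open>j = 0\<close> forbids this.\<close>
      have "mass n C = 0" using void small by auto
      then show ?thesis
        using en[of 0] spread_le_mass[of n D] \<open>D n \<le> mass n D\<close> \<open>0 < D n\<close> \<open>1 \<le> n\<close>
        by (simp add: admissible_def enough_def)
    qed
  qed
qed

section \<open>The double induction\<close>

lemma solvable_if_enough:
  assumes "1 \<le> k" "\<And>j. admissible n k j \<Longrightarrow> enough n k D C j"
  shows "solvable (path_power n k) D C"
  using assms(2)
proof (induction n arbitrary: D C rule: less_induct)
  case (less n)
  note IH = less.IH
  from less.prems show ?case
  proof (induction "mass n C" arbitrary: C D rule: less_induct)
    case less
    note IH' = less.hyps and en = less.prems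
    show ?case
    proof (cases "\<exists>v\<in>{1..n}. 1 \<le> C v \<and> 1 \<le> D v")
      case True
      then obtain v where v: "v \<in> {1..n}" "1 \<le> C v" "1 \<le> D v" by blast
      have "mass n (C(v := C v - 1)) < mass n C"
        using mass_upd[OF v(1), of C "C v - 1"] v by linarith
      then have "solvable (path_power n k) (D(v := D v - 1)) (C(v := C v - 1))"
        by (intro IH' enough_cancel en v)
      then show ?thesis using v by (intro solvable_cancel[of C v])
    next
      case False
      then have disj: "C v = 0" if "v \<in> {1..n}" "0 < D v" for v using that by force
      \<comment> \<open>A single vertex without demand is set apart because the split needs two
        distinct ends.\<close>
      consider "n = 0" | "1 \<le> n" "0 < D n" | "1 \<le> n" "0 < D 1" | "n = 1" "D 1 = 0"
        | "2 \<le> n" "D 1 = 0" "D n = 0" by force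
      then show ?thesis
      proof cases
        case 1
        then show ?thesis by (intro solvable_if_le) simp
      next
        case 2
        show ?thesis by (rule solvable_top) (fact IH IH' disj en 2 \<open>1 \<le> k\<close>)+
      next
        case 3
        let ?D = "\<lambda>v. D (n + 1 - v)" and ?C = "\<lambda>v. C (n + 1 - v)"
        have "solvable (path_power n k) ?D ?C"
        proof (rule solvable_top)
          show "solvable (path_power n k) D' C'"
            if "mass n C' < mass n ?C" "\<And>j. admissible n k j \<Longrightarrow> enough n k D' C' j" for D' C'
            using that IH' unfolding mass_reflect by blast
          show "enough n k ?D ?C j" if "admissible n k j" for j
            using en[OF that] unfolding enough_def mass_reflect spread_reflect .
          show "?C v = 0" if "v \<in> {1..n}" "0 < ?D v" for v
            by (rule disj) (use that in auto)
          show "0 < ?D n" using 3 by simp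
        qed (fact IH 3 \<open>1 \<le> k\<close>)+
        then show ?thesis by (rule solvable_path_power_reflect)
      next
        case 4
        then show ?thesis by (intro solvable_if_le) simp
      next
        case 5
        show ?thesis by (rule solvable_split) (fact IH disj en 5)+
      qed
    qed
  qed
qed

section \<open>Convexity in \<open>j\<close> and the final bound\<close>

text \<open>Going from \<open>i\<close> to \<open>i + 1\<close> in place of \<open>j\<close> changes
  the left side by \<open>t * 2 ^ (i + 1) - k\<close>, which grows with \<open>i\<close>. If
  \<open>t * 2 ^ j \<le> k\<close>, no step before \<open>j\<close> increases it, so the value at 0
  is a bound; otherwise every step from \<open>j\<close> on increases it, so the value at
  \<open>J\<close> is.\<close>

lemma convexity_bound:
  fixes t k j J :: nat
  assumes "j \<le> J"
  shows "t * 2 ^ (j + 1) + k * (J - j) \<le> max (t * 2 ^ (J + 1)) (2 * t + k * J)"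
proof (cases "t * 2 ^ j \<le> k")
  case True
  have "t * 2 ^ (i + 1) \<le> 2 * t + k * i" if "i \<le> j" for i
    using that
  proof (induction i)
    case (Suc i)
    have "t * 2 ^ (i + 1) \<le> t * 2 ^ j" using Suc.prems by (intro mult_left_mono power_increasing) auto
    moreover have "t * 2 ^ (Suc i + 1) = t * 2 ^ (i + 1) + t * 2 ^ (i + 1)" by simp
    moreover have "k * Suc i = k * i + k" by simp
    moreover have "t * 2 ^ (i + 1) \<le> 2 * t + k * i" using Suc by simp
    ultimately show ?case using True by linarith
  qed simp
  from this[of j] have "t * 2 ^ (j + 1) + k * (J - j) \<le> 2 * t + k * j + k * (J - j)" by simp
  also have "\<dots> = 2 * t + k * J" using assms by (simp add: diff_mult_distrib2)
  finally show ?thesis by simp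
next
  case False
  have "t * 2 ^ (j + 1) + k * i \<le> t * 2 ^ (j + i + 1)" for i
  proof (induction i)
    case (Suc i)
    have "t * 2 ^ j \<le> t * 2 ^ (j + i + 1)" by (intro mult_left_mono power_increasing) auto
    moreover have "t * 2 ^ (j + Suc i + 1) = t * 2 ^ (j + i + 1) + t * 2 ^ (j + i + 1)" by simp
    moreover have "k * Suc i = k * i + k" by simp
    ultimately show ?case using Suc False by linarith
  qed simp
  from this[of "J - j"] show ?thesis using assms by simp
qed

theorem theorem5:
  fixes n k t :: nat and D :: "nat \<Rightarrow> nat"
  assumes "n \<ge> 2" and "k \<ge> 1" and "t \<ge> 1"
    and "distr_size (path_power n k) D = t"
  shows "int (pebbling_number (path_power n k) D)
           \<le> int (pp_p t n k) - int (distr_supp (path_power n k) D) + 1"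
proof -
  have t: "mass n D = t" using assms(4) by (simp add: distr_size_def)
  have s: "distr_supp (path_power n k) D = spread n D" by (simp add: distr_supp_def)
  define J where "J = (n - 2) div k"
  have n: "n - 2 = k * J + pp_rest n k"
    unfolding pp_rest_def pp_diam_def J_def by (simp del: diff_diff_left)
  have "t \<le> pp_p t n k" using assms(1) by (simp add: pp_p_def pp_w_def)
  \<comment> \<open>This keeps the natural subtraction in the bound below from truncating.\<close>
  then have "spread n D \<le> pp_p t n k" using spread_le_mass[of n D] t by simp
  have "pebbling_number (path_power n k) D \<le> pp_p t n k + 1 - spread n D"
    unfolding pebbling_number_def
  proof (intro Least_le allI impI)
    fix C assume C: "pp_p t n k + 1 - spread n D \<le> distr_size (path_power n k) C"
    show "solvable (path_power n k) D C"
    proof (rule solvable_if_enough[OF assms(2)])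
      fix j assume "admissible n k j"
      then have "k * j \<le> n - 2" using assms(1) by (auto simp: admissible_def)
      then have "j \<le> J" unfolding J_def using assms(2) by (simp add: less_eq_div_iff_mult_less_eq mult.commute)
      \<comment> \<open>Adding \<open>pp_rest n k\<close> turns the two end values into
        \<open>pp_l t n k\<close> and \<open>pp_w t n\<close>.\<close>
      have "t * 2 ^ (j + 1) + k * (J - j) + pp_rest n k \<le> pp_p t n k"
        using convexity_bound[OF \<open>j \<le> J\<close>, of t k] n assms(1)
        unfolding pp_p_def pp_l_def pp_w_def pp_diam_def J_def[symmetric] by linarith
      moreover have "k * (J - j) + pp_rest n k + k * j + 2 = n"
      proof -
        have "k * (J - j) + k * j = k * J"
          using \<open>j \<le> J\<close> by (metis distrib_left le_add_diff_inverse2)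
        with n assms(1) show ?thesis by simp
      qed
      ultimately show "enough n k D C j"
        using C unfolding enough_def t by (simp add: distr_size_def)
    qed
  qed
  with \<open>spread n D \<le> pp_p t n k\<close> show ?thesis unfolding s by linarith
qed

end
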